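(* Let $\Omega,\Omega'\subset\mathbb{H}_1$ be open, let $f:\Omega\to\mathbb{H}_1$ be a smooth positively oriented contact map and let $g=(G,g_3):\Omega'\to\Omega$ be a positively oriented conformal map. Then $$S_{CR}(f\circ g)=(S_{CR}(f)\circ g)\,(ZG)^2\quad\text{on }\Omega'.$$
   Context: The Heisenberg group $\mathbb{H}_1$ is $\mathbb{C}\times\mathbb{R}$ with coordinates $(z,t)$, $z=x+iy$, and product $(z_1,t_1)(z_2,t_2)=(z_1+z_2,\,t_1+t_2+2\,\mathrm{Im}(z_1\bar z_2))$. Put $X=\partial_x+2y\,\partial_t$, $Y=\partial_y-2x\,\partial_t$, $Z=\frac12(X-iY)$, $\bar Z=\frac12(X+iY)$, $\theta=dt-2y\,dx+2x\,dy$. A local diffeomorphism $f=(f_1+if_2,f_3)$ is contact if $f^*\theta=\lambda_f\theta$ with $\lambda_f$ nowhere zero; it is positively oriented if $\lambda_f>0$. A contact map is conformal if $(Xf_1)^2+(Xf_2)^2=(Yf_1)^2+(Yf_2)^2$ and $(Xf_1)(Yf_1)+(Xf_2)(Yf_2)=0$; conformal maps are known to be $C^\infty$. The CR Schwarzian derivative of a positively oriented contact map is $S_{CR}(f)=\frac12\lambda_f\,Z^2(\lambda_f^{-1})$. *)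

theory Defs
  imports "HOL-Analysis.Analysis"
begin

(* Euclidean C^k and smooth maps; the sets of interest are open and the domain
   is finite-dimensional. *)

fun Ck_on :: "nat \<Rightarrow> 'a::euclidean_space set \<Rightarrow> ('a \<Rightarrow> 'b::real_normed_vector) \<Rightarrow> bool" where
  "Ck_on 0 S f \<longleftrightarrow> continuous_on S f"
| "Ck_on (Suc k) S f \<longleftrightarrow>
     (\<forall>p\<in>S. f differentiable (at p)) \<and>
     (\<forall>v. Ck_on k S (\<lambda>p. frechet_derivative f (at p) v))"

definition smooth_on :: "'a::euclidean_space set \<Rightarrow> ('a \<Rightarrow> 'b::real_normed_vector) \<Rightarrow> bool" where
  "smooth_on S f \<longleftrightarrow> (\<forall>k. Ck_on k S f)"

definition local_diffeo_on :: "'a::euclidean_space set \<Rightarrow> ('a \<Rightarrow> 'a) \<Rightarrow> bool" where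
  "local_diffeo_on S f \<longleftrightarrow>
     (\<forall>p\<in>S. \<exists>U V h. open U \<and> p \<in> U \<and> U \<subseteq> S \<and> open V \<and>
        homeomorphism U V f h \<and> Ck_on 1 U f \<and> Ck_on 1 V h)"

(* Points (z, t) with z = x + i y. Tangent vectors at any point are identified with
   elements of the same vector space, so d/dx, d/dy, d/dt are (1,0), (\<i>,0), (0,1). *)

type_synonym heis = "complex \<times> real"

definition fieldX :: "heis \<Rightarrow> heis" where
  "fieldX p = (1, 2 * Im (fst p))"

definition fieldY :: "heis \<Rightarrow> heis" where
  "fieldY p = (\<i>, - 2 * Re (fst p))"

definition dX :: "(heis \<Rightarrow> 'b::real_normed_vector) \<Rightarrow> heis \<Rightarrow> 'b" where
  "dX u p = frechet_derivative u (at p) (fieldX p)"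

definition dY :: "(heis \<Rightarrow> 'b::real_normed_vector) \<Rightarrow> heis \<Rightarrow> 'b" where
  "dY u p = frechet_derivative u (at p) (fieldY p)"

definition dZ :: "(heis \<Rightarrow> complex) \<Rightarrow> heis \<Rightarrow> complex" where
  "dZ u p = (dX u p - \<i> * dY u p) / 2"

definition theta :: "heis \<Rightarrow> heis \<Rightarrow> real" where
  "theta p v = snd v - 2 * Im (fst p) * Re (fst v) + 2 * Re (fst p) * Im (fst v)"

definition pullback_theta :: "(heis \<Rightarrow> heis) \<Rightarrow> heis \<Rightarrow> heis \<Rightarrow> real" where
  "pullback_theta f p v = theta (f p) (frechet_derivative f (at p) v)"

definition contact_on :: "heis set \<Rightarrow> (heis \<Rightarrow> heis) \<Rightarrow> bool" where
  "contact_on S f \<longleftrightarrow> local_diffeo_on S f \<and>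
     (\<exists>l. \<forall>p\<in>S. l p \<noteq> 0 \<and> (\<forall>v. pullback_theta f p v = l p * theta p v))"

definition contact_factor :: "(heis \<Rightarrow> heis) \<Rightarrow> heis \<Rightarrow> real" where
  "contact_factor f p = (THE c. \<forall>v. pullback_theta f p v = c * theta p v)"

lemma contact_factor_unique:
  assumes "\<forall>v. pullback_theta f p v = c * theta p v"
  shows "contact_factor f p = c"
  unfolding contact_factor_def
proof (rule the_equality)
  fix d assume "\<forall>v. pullback_theta f p v = d * theta p v"
  then have "d * theta p (0, 1) = c * theta p (0, 1)"
    using assms by metis
  then show "d = c"
    by (simp add: theta_def)
qed (fact assms)

definition pos_contact_on :: "heis set \<Rightarrow> (heis \<Rightarrow> heis) \<Rightarrow> bool" where
  "pos_contact_on S f \<longleftrightarrow> contact_on S f \<and> (\<forall>p\<in>S. contact_factor f p > 0)"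

definition conformal_on :: "heis set \<Rightarrow> (heis \<Rightarrow> heis) \<Rightarrow> bool" where
  "conformal_on S f \<longleftrightarrow> contact_on S f \<and>
     (let f1 = (\<lambda>p. Re (fst (f p))); f2 = (\<lambda>p. Im (fst (f p))) in
      \<forall>p\<in>S. (dX f1 p)\<^sup>2 + (dX f2 p)\<^sup>2 = (dY f1 p)\<^sup>2 + (dY f2 p)\<^sup>2 \<and>
            dX f1 p * dY f1 p + dX f2 p * dY f2 p = 0)"

definition S_CR :: "(heis \<Rightarrow> heis) \<Rightarrow> heis \<Rightarrow> complex" where
  "S_CR f p = 1 / 2 * complex_of_real (contact_factor f p) *
     dZ (dZ (\<lambda>q. complex_of_real (inverse (contact_factor f q)))) p"

end

(* Write g = (G, g_3), let lambda be the contact factor of g and T = d/dt, so that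
   [Zbar, Z] = 2 i T and T commutes with Z and Zbar. Comparing Zbar Z g_3 with Z Zbar g_3 by means of
   the contact equations gives lambda = |ZG|^2 - |Zbar G|^2. Conformality says
   ZG * conj (Zbar G) = 0, so lambda positive forces Zbar G = 0 and lambda = |ZG|^2.
   With a = ZG and b = conj a = Zbar (conj G) one then gets Z b = -2 i T (conj G), hence Z^2 b = 0,
   and Z lambda = 2 i a T (conj G), hence b Z a = -2 a Z b. These two relations yield
   Z^2 (1 / lambda) = 0 and (Z^2 G) / lambda + 2 ZG Z (1 / lambda) = 0, which are exactly what kills
   the lower-order terms when Z^2 is applied to
   1 / lambda_(f o g) = (1 / lambda_f o g) * (1 / lambda). *)

theory Submission
  imports Defs
begin

section \<open>Smooth maps and directional derivatives\<close>

text \<open>Constant directions come first because \<open>Ck_on\<close> recurses over them.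
  \<open>X\<close> and \<open>Y\<close>, whose coefficients vary with the point, are reduced to them
  later.\<close>

abbreviation ddir :: "'a::real_normed_vector \<Rightarrow> ('a \<Rightarrow> 'b::real_normed_vector) \<Rightarrow> 'a \<Rightarrow> 'b" where
  "ddir v u p \<equiv> frechet_derivative u (at p) v"

text \<open>\<open>frechet_derivative\<close> selects among all derivatives at the point, and
  functions agreeing on a neighbourhood have the same ones. Hence no differentiability has to be
  assumed.\<close>

lemma ddir_cong:
  assumes "open S" "p \<in> S" "\<And>q. q \<in> S \<Longrightarrow> u q = w q"
  shows "ddir v u p = ddir v w p"
proof -
  have "(u has_derivative D) (at p) = (w has_derivative D) (at p)" for D
    using assms has_derivative_transform_within_open[of _ _ p UNIV S] by metis
  then show ?thesis
    by (simp add: frechet_derivative_def)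
qed

lemma Ck_on_cong:
  assumes "open S" "\<And>q. q \<in> S \<Longrightarrow> u q = w q"
  shows "Ck_on k S u \<longleftrightarrow> Ck_on k S w"
  using assms(2)
proof (induction k arbitrary: u w)
  case 0
  then show ?case by (simp cong: continuous_on_cong)
next
  case (Suc k)
  have "u differentiable (at p) \<longleftrightarrow> w differentiable (at p)" if "p \<in> S" for p
    using that Suc.prems assms(1) has_derivative_transform_within_open[of _ _ p UNIV S]
    unfolding differentiable_def by metis
  moreover have "Ck_on k S (ddir v u) \<longleftrightarrow> Ck_on k S (ddir v w)" for v
    by (intro Suc.IH ddir_cong[OF assms(1)] Suc.prems)
  ultimately show ?case by simp
qed

lemma Ck_on_SucD: "Ck_on (Suc k) S u \<Longrightarrow> Ck_on k S u"
proof (induction k arbitrary: u)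
  case 0
  then show ?case
    by (auto intro!: differentiable_imp_continuous_on simp: differentiable_on_def
        differentiable_at_withinI)
qed auto

lemma Ck_on_const: "Ck_on k S (\<lambda>_. c)"
  by (induction k arbitrary: c) auto

lemma Ck_on_linear:
  assumes "bounded_linear L" shows "Ck_on k S L"
proof (cases k)
  case 0
  then show ?thesis using assms by (simp add: linear_continuous_on)
next
  case (Suc m)
  have "ddir v L = (\<lambda>_. L v)" for v
    using frechet_derivative_at[OF bounded_linear_imp_has_derivative[OF assms]] by metis
  then show ?thesis
    using Suc assms by (simp add: Ck_on_const bounded_linear_imp_differentiable)
qed

lemma ddir_linear_compose:
  assumes "bounded_linear L" "u differentiable (at p)"
  shows "ddir v (\<lambda>q. L (u q)) p = L (ddir v u p)"
proof -
  have "((\<lambda>q. L (u q)) has_derivative (\<lambda>v. L (ddir v u p))) (at p)"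
    using assms bounded_linear.has_derivative frechet_derivative_works by blast
  from frechet_derivative_at[OF this] show ?thesis by metis
qed

lemma Ck_on_linear_compose:
  assumes "bounded_linear L" "open S" "Ck_on k S u"
  shows "Ck_on k S (\<lambda>q. L (u q))"
  using assms(3)
proof (induction k arbitrary: u)
  case 0
  then show ?case
    using assms(1) by (auto intro: bounded_linear.continuous_on)
next
  case (Suc k)
  have "(\<lambda>q. L (u q)) differentiable (at p)" if "p \<in> S" for p
    using that Suc.prems assms(1) bounded_linear.has_derivative
    unfolding Ck_on.simps differentiable_def by blast
  moreover have "Ck_on k S (ddir v (\<lambda>q. L (u q)))" for v
  proof (subst Ck_on_cong[OF assms(2)])
    show "Ck_on k S (\<lambda>p. L (ddir v u p))" using Suc by auto
    show "ddir v (\<lambda>q. L (u q)) p = L (ddir v u p)" if "p \<in> S" for p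
      using Suc.prems that by (intro ddir_linear_compose[OF assms(1)]) auto
  qed
  ultimately show ?case by simp
qed

lemma ddir_add:
  assumes "u differentiable (at p)" "w differentiable (at p)"
  shows "ddir v (\<lambda>q. u q + w q) p = ddir v u p + ddir v w p"
proof -
  have "((\<lambda>q. u q + w q) has_derivative (\<lambda>v. ddir v u p + ddir v w p)) (at p)"
    using assms by (auto intro!: has_derivative_add simp: frechet_derivative_works)
  from frechet_derivative_at[OF this] show ?thesis by metis
qed

lemma Ck_on_add:
  assumes "open S" "Ck_on k S u" "Ck_on k S w"
  shows "Ck_on k S (\<lambda>q. u q + w q)"
  using assms(2,3)
proof (induction k arbitrary: u w)
  case 0
  then show ?case by (simp add: continuous_on_add)
next
  case (Suc k)
  then have "Ck_on k S (ddir v (\<lambda>q. u q + w q))" for v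
    by (subst Ck_on_cong[OF assms(1), where w = "\<lambda>p. ddir v u p + ddir v w p"])
      (auto simp: ddir_add)
  with Suc show ?case by simp
qed

lemma ddir_mult:
  fixes u w :: "'a::real_normed_vector \<Rightarrow> 'b::real_normed_algebra"
  assumes "u differentiable (at p)" "w differentiable (at p)"
  shows "ddir v (\<lambda>q. u q * w q) p = ddir v u p * w p + u p * ddir v w p"
proof -
  have "((\<lambda>q. u q * w q) has_derivative (\<lambda>v. u p * ddir v w p + ddir v u p * w p)) (at p)"
    using assms by (auto intro!: has_derivative_mult simp: frechet_derivative_works)
  from frechet_derivative_at[OF this] show ?thesis by (metis add.commute)
qed

lemma Ck_on_mult:
  fixes u w :: "'a::euclidean_space \<Rightarrow> 'b::real_normed_algebra"
  assumes "open S" "Ck_on k S u" "Ck_on k S w"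
  shows "Ck_on k S (\<lambda>q. u q * w q)"
  using assms(2,3)
proof (induction k arbitrary: u w)
  case 0
  then show ?case by (simp add: continuous_on_mult)
next
  case (Suc k)
  \<comment> \<open>The product rule pairs the derivative of one factor with the other factor
    itself, so the factors are needed at level \<open>k\<close> too.\<close>
  note Ck = Suc.prems[THEN Ck_on_SucD]
  have "Ck_on k S (ddir v (\<lambda>q. u q * w q))" for v
    using Suc.prems Ck
    by (subst Ck_on_cong[OF assms(1), where w = "\<lambda>p. ddir v u p * w p + u p * ddir v w p"])
      (auto simp: ddir_mult intro!: Ck_on_add assms(1) Suc.IH)
  with Suc show ?case by simp
qed

lemma ddir_inverse:
  fixes u :: "'a::real_normed_vector \<Rightarrow> 'b::real_normed_field"
  assumes "u differentiable (at p)" "u p \<noteq> 0"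
  shows "ddir v (\<lambda>q. inverse (u q)) p = - (inverse (u p) * ddir v u p * inverse (u p))"
proof -
  have "((\<lambda>q. inverse (u q)) has_derivative
      (\<lambda>v. - (inverse (u p) * ddir v u p * inverse (u p)))) (at p)"
    using assms by (auto intro!: has_derivative_inverse simp: frechet_derivative_works)
  from frechet_derivative_at[OF this] show ?thesis by metis
qed

text \<open>The induction keeps \<open>u\<close> fixed: the derivative of \<open>1/u\<close> is a
  product containing \<open>1/u\<close> again, to which the induction hypothesis applies one level
  lower.\<close>

lemma Ck_on_inverse:
  fixes u :: "'a::euclidean_space \<Rightarrow> 'b::real_normed_field"
  assumes "open S" "Ck_on k S u" "\<And>q. q \<in> S \<Longrightarrow> u q \<noteq> 0"
  shows "Ck_on k S (\<lambda>q. inverse (u q))"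
  using assms(2)
proof (induction k)
  case 0
  then show ?case using assms(3) by (simp add: continuous_on_inverse)
next
  case (Suc k)
  have inv: "Ck_on k S (\<lambda>q. inverse (u q))"
    using Suc.IH Suc.prems Ck_on_SucD by blast
  have "Ck_on k S (ddir v (\<lambda>q. inverse (u q)))" for v
  proof (subst Ck_on_cong[OF assms(1)])
    show "Ck_on k S (\<lambda>p. - 1 * (inverse (u p) * ddir v u p * inverse (u p)))"
      using Suc.prems inv by (intro Ck_on_mult assms(1) Ck_on_const) auto
  qed (use Suc.prems assms(3) in \<open>auto simp: ddir_inverse\<close>)
  moreover have "(\<lambda>q. inverse (u q)) differentiable (at p)" if "p \<in> S" for p
    using that Suc.prems assms(3) by (auto intro!: differentiable_inverse)
  ultimately show ?case by simp
qed

lemma ddir_compose: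
  assumes "g differentiable (at p)" "u differentiable (at (g p))"
  shows "ddir v (\<lambda>q. u (g q)) p = ddir (ddir v g p) u (g p)"
  using frechet_derivative_compose[OF assms] by (simp add: comp_def fun_eq_iff)

section \<open>Symmetry of second derivatives\<close>

lemma ray_has_real_derivative:
  fixes u :: "'a::real_normed_vector \<Rightarrow> real"
  assumes "u differentiable (at (q + t *\<^sub>R a))"
  shows "((\<lambda>t. u (q + t *\<^sub>R a)) has_real_derivative ddir a u (q + t *\<^sub>R a)) (at t)"
proof -
  let ?D = "frechet_derivative u (at (q + t *\<^sub>R a))"
  have D: "(u has_derivative ?D) (at (q + t *\<^sub>R a))"
    using assms by (simp add: frechet_derivative_works)
  have "((\<lambda>t. q + t *\<^sub>R a) has_derivative (\<lambda>s. s *\<^sub>R a)) (at t)"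
    by (auto intro!: derivative_eq_intros)
  from has_derivative_compose[OF this D]
  have "((\<lambda>t. u (q + t *\<^sub>R a)) has_derivative (\<lambda>s. ?D (s *\<^sub>R a))) (at t)" .
  moreover have "(\<lambda>s. ?D (s *\<^sub>R a)) = (*) (?D a)"
    using linear_frechet_derivative[OF assms] by (auto simp: linear_cmul mult.commute)
  ultimately show ?thesis by (simp add: has_field_derivative_def)
qed

text \<open>The mean value theorem is applied along \<open>a\<close> to the difference of
  \<open>u\<close> across two opposite sides of a parallelogram, then along \<open>b\<close> to the
  resulting derivative. The second difference is symmetric in \<open>a\<close> and \<open>b\<close>,
  the right-hand side visibly is not; this gives the symmetry below.\<close>

lemma second_difference_mean_value:
  fixes u :: "'a::real_normed_vector \<Rightarrow> real"
  assumes "\<And>q. q \<in> ball p e \<Longrightarrow> u differentiable (at q)"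
    and "\<And>q. q \<in> ball p e \<Longrightarrow> ddir a u differentiable (at q)"
    and s: "0 < s" "s * (norm a + norm b) < e"
  obtains \<xi> where "\<xi> \<in> ball p e"
    "u (p + s *\<^sub>R a + s *\<^sub>R b) - u (p + s *\<^sub>R a) - u (p + s *\<^sub>R b) + u p = s * s * ddir b (ddir a u) \<xi>"
proof -
  have box: "p + t *\<^sub>R a + r *\<^sub>R b \<in> ball p e" if "0 \<le> t" "t \<le> s" "0 \<le> r" "r \<le> s" for t r
  proof -
    have "norm (t *\<^sub>R a + r *\<^sub>R b) \<le> t * norm a + r * norm b"
      using norm_triangle_ineq[of "t *\<^sub>R a" "r *\<^sub>R b"] that by simp
    also have "\<dots> \<le> s * norm a + s * norm b"
      using that by (intro add_mono mult_right_mono) auto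
    finally show ?thesis
      using s by (simp add: dist_norm algebra_simps norm_minus_commute)
  qed
  \<comment> \<open>The second difference is \<open>\<phi> s - \<phi> 0\<close>.\<close>
  define \<phi> where "\<phi> t = u (p + s *\<^sub>R b + t *\<^sub>R a) - u (p + t *\<^sub>R a)" for t
  have "(\<phi> has_real_derivative ddir a u (p + s *\<^sub>R b + t *\<^sub>R a) - ddir a u (p + t *\<^sub>R a)) (at t)"
    if "0 \<le> t" "t \<le> s" for t
    unfolding \<phi>_def using box[OF that, of 0] box[OF that, of s] s
    by (intro DERIV_diff ray_has_real_derivative assms(1)) (auto simp: algebra_simps)
  from MVT2[OF s(1) this] obtain t where t: "0 < t" "t < s"
    "\<phi> s - \<phi> 0 = s * (ddir a u (p + s *\<^sub>R b + t *\<^sub>R a) - ddir a u (p + t *\<^sub>R a))"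
    by auto
  have "((\<lambda>r. ddir a u (p + t *\<^sub>R a + r *\<^sub>R b)) has_real_derivative
      ddir b (ddir a u) (p + t *\<^sub>R a + r *\<^sub>R b)) (at r)" if "0 \<le> r" "r \<le> s" for r
    using t box[of t r] that by (intro ray_has_real_derivative assms(2)) auto
  from MVT2[OF s(1) this] obtain r where r: "0 < r" "r < s"
    "ddir a u (p + t *\<^sub>R a + s *\<^sub>R b) - ddir a u (p + t *\<^sub>R a)
      = s * ddir b (ddir a u) (p + t *\<^sub>R a + r *\<^sub>R b)"
    by auto
  show thesis
  proof (rule that)
    show "p + t *\<^sub>R a + r *\<^sub>R b \<in> ball p e" using t r by (intro box) auto
    show "u (p + s *\<^sub>R a + s *\<^sub>R b) - u (p + s *\<^sub>R a) - u (p + s *\<^sub>R b) + u p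
      = s * s * ddir b (ddir a u) (p + t *\<^sub>R a + r *\<^sub>R b)"
      using t(3) r(3) by (simp add: \<phi>_def add.commute add.left_commute)
  qed
qed

text \<open>One second difference equals \<open>s * s\<close> times either mixed derivative, each at
  some point near \<open>p\<close>. By continuity at \<open>p\<close> the two mixed derivatives
  cannot differ there.\<close>

lemma ddir_commute_real:
  fixes u :: "'a::euclidean_space \<Rightarrow> real"
  assumes "open S" "p \<in> S" "Ck_on 2 S u"
  shows "ddir a (ddir b u) p = ddir b (ddir a u) p"
proof (rule ccontr)
  assume ne: "ddir a (ddir b u) p \<noteq> ddir b (ddir a u) p"
  \<comment> \<open>With half the gap as tolerance, values within \<open>d\<close> of the two sides
    can never coincide.\<close>
  define d where "d = \<bar>ddir a (ddir b u) p - ddir b (ddir a u) p\<bar> / 2"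
  have d: "d > 0" using ne by (simp add: d_def)
  have C: "Ck_on (Suc (Suc 0)) S u" using assms(3) by (simp add: numeral_2_eq_2)
  have cont: "isCont (ddir v (ddir w u)) p" for v w
    using C assms(1,2) by (simp add: continuous_on_eq_continuous_at)
  obtain e1 where e1: "e1 > 0" "\<And>q. dist q p < e1 \<Longrightarrow> \<bar>ddir a (ddir b u) q - ddir a (ddir b u) p\<bar> < d"
    using cont[where v=a and w=b] d unfolding continuous_at_eps_delta by (auto simp: dist_real_def)
  obtain e2 where e2: "e2 > 0" "\<And>q. dist q p < e2 \<Longrightarrow> \<bar>ddir b (ddir a u) q - ddir b (ddir a u) p\<bar> < d"
    using cont[where v=b and w=a] d unfolding continuous_at_eps_delta by (auto simp: dist_real_def)
  obtain e3 where e3: "e3 > 0" "ball p e3 \<subseteq> S"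
    using assms(1,2) open_contains_ball by blast
  define e where "e = min e1 (min e2 e3)"
  have e: "e > 0" "e \<le> e1" "e \<le> e2" "ball p e \<subseteq> S"
    using e1(1) e2(1) e3 by (auto simp: e_def)
  \<comment> \<open>The summand 1 keeps the denominator positive when \<open>a\<close> and
    \<open>b\<close> vanish and makes the size bounds strict.\<close>
  define s where "s = e / (norm a + norm b + 1)"
  have n: "norm a + norm b + 1 > 0" by (simp add: add_nonneg_pos)
  have s: "0 < s" "s * (norm a + norm b) < e" "s * (norm b + norm a) < e"
    using e(1) n by (auto simp: s_def field_simps)
  have diff: "u differentiable (at q)" "ddir v u differentiable (at q)" if "q \<in> ball p e" for q v
    using C e(4) that by auto
  obtain \<xi> where \<xi>: "\<xi> \<in> ball p e"
    "u (p + s *\<^sub>R a + s *\<^sub>R b) - u (p + s *\<^sub>R a) - u (p + s *\<^sub>R b) + u p = s * s * ddir b (ddir a u) \<xi>"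
    by (rule second_difference_mean_value[OF diff s(1,2)])
  obtain \<eta> where \<eta>: "\<eta> \<in> ball p e"
    "u (p + s *\<^sub>R b + s *\<^sub>R a) - u (p + s *\<^sub>R b) - u (p + s *\<^sub>R a) + u p = s * s * ddir a (ddir b u) \<eta>"
    by (rule second_difference_mean_value[OF diff s(1,3)])
  have "p + s *\<^sub>R b + s *\<^sub>R a = p + s *\<^sub>R a + s *\<^sub>R b" by simp
  then have "s * s * ddir a (ddir b u) \<eta> = s * s * ddir b (ddir a u) \<xi>"
    using \<xi>(2) \<eta>(2) by (simp only:)
  then have "ddir a (ddir b u) \<eta> = ddir b (ddir a u) \<xi>"
    using s(1) by simp
  moreover have "\<bar>ddir a (ddir b u) \<eta> - ddir a (ddir b u) p\<bar> < d"
    using \<eta>(1) e by (intro e1(2)) (auto simp: dist_commute)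
  moreover have "\<bar>ddir b (ddir a u) \<xi> - ddir b (ddir a u) p\<bar> < d"
    using \<xi>(1) e by (intro e2(2)) (auto simp: dist_commute)
  ultimately show False unfolding d_def by (auto simp: abs_if split: if_splits)
qed

text \<open>The mean value argument is confined to real values; real and imaginary parts are bounded
  linear and so pass through \<open>ddir\<close>.\<close>

lemma ddir_commute:
  fixes u :: "'a::euclidean_space \<Rightarrow> complex"
  assumes "open S" "p \<in> S" "Ck_on 2 S u"
  shows "ddir a (ddir b u) p = ddir b (ddir a u) p"
proof -
  have C: "Ck_on (Suc (Suc 0)) S u" using assms(3) by (simp add: numeral_2_eq_2)
  have *: "L (ddir a (ddir b u) p) = L (ddir b (ddir a u) p)" if L: "bounded_linear L"
    for L :: "complex \<Rightarrow> real"
  proof -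
    have "ddir v (ddir w (\<lambda>q. L (u q))) p = L (ddir v (ddir w u) p)" for v w
    proof -
      have "ddir v (ddir w (\<lambda>q. L (u q))) p = ddir v (\<lambda>q. L (ddir w u q)) p"
        using C by (intro ddir_cong[OF assms(1,2)] ddir_linear_compose[OF L]) auto
      also have "\<dots> = L (ddir v (ddir w u) p)"
        using C assms(2) by (intro ddir_linear_compose[OF L]) auto
      finally show ?thesis .
    qed
    then show ?thesis
      using ddir_commute_real[OF assms(1,2) Ck_on_linear_compose[OF L assms(1,3)], of a b] by simp
  qed
  show ?thesis
    by (intro complex_eqI * bounded_linear_Re bounded_linear_Im)
qed

section \<open>Closure properties of smooth functions\<close>

lemma smooth_on_Ck: "smooth_on S u \<Longrightarrow> Ck_on k S u"
  by (simp add: smooth_on_def)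

lemma smooth_on_cong:
  assumes "open S" "smooth_on S w" "\<And>q. q \<in> S \<Longrightarrow> u q = w q"
  shows "smooth_on S u"
  using assms Ck_on_cong[OF assms(1), of u w] by (simp add: smooth_on_def)

lemma smooth_on_differentiable: "smooth_on S u \<Longrightarrow> p \<in> S \<Longrightarrow> u differentiable (at p)"
  using smooth_on_Ck[of S u "Suc 0"] by simp

lemma smooth_on_ddir: "smooth_on S u \<Longrightarrow> smooth_on S (ddir v u)"
  unfolding smooth_on_def
proof
  fix k
  assume "\<forall>k. Ck_on k S u"
  then have "Ck_on (Suc k) S u" ..
  then show "Ck_on k S (ddir v u)" by simp
qed

lemma smooth_on_add: "open S \<Longrightarrow> smooth_on S u \<Longrightarrow> smooth_on S w \<Longrightarrow> smooth_on S (\<lambda>q. u q + w q)"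
  by (simp add: smooth_on_def Ck_on_add)

lemma smooth_on_mult:
  fixes u w :: "'a::euclidean_space \<Rightarrow> 'b::real_normed_algebra"
  shows "open S \<Longrightarrow> smooth_on S u \<Longrightarrow> smooth_on S w \<Longrightarrow> smooth_on S (\<lambda>q. u q * w q)"
  by (simp add: smooth_on_def Ck_on_mult)

lemma smooth_on_const: "smooth_on S (\<lambda>_. c)"
  by (simp add: smooth_on_def Ck_on_const)

lemma smooth_on_linear: "bounded_linear L \<Longrightarrow> smooth_on S L"
  by (simp add: smooth_on_def Ck_on_linear)

lemma smooth_on_linear_compose:
  "bounded_linear L \<Longrightarrow> open S \<Longrightarrow> smooth_on S u \<Longrightarrow> smooth_on S (\<lambda>q. L (u q))"
  by (simp add: smooth_on_def Ck_on_linear_compose)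

lemma smooth_on_inverse:
  fixes u :: "'a::euclidean_space \<Rightarrow> 'b::real_normed_field"
  shows "open S \<Longrightarrow> smooth_on S u \<Longrightarrow> (\<And>q. q \<in> S \<Longrightarrow> u q \<noteq> 0) \<Longrightarrow> smooth_on S (\<lambda>q. inverse (u q))"
  by (simp add: smooth_on_def Ck_on_inverse)

lemma smooth_on_cnj: "open S \<Longrightarrow> smooth_on S u \<Longrightarrow> smooth_on S (\<lambda>q. cnj (u q))"
  by (rule smooth_on_linear_compose[OF bounded_linear_cnj])

lemma ddir_cnj: "u differentiable (at p) \<Longrightarrow> ddir v (\<lambda>q. cnj (u q)) p = cnj (ddir v u p)"
  by (rule ddir_linear_compose[OF bounded_linear_cnj])

lemma ddir_lincomb:
  fixes u w :: "'a::real_normed_vector \<Rightarrow> 'b::real_normed_algebra"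
  assumes "u differentiable (at p)" "w differentiable (at p)"
  shows "ddir v (\<lambda>q. c * u q + d * w q) p = c * ddir v u p + d * ddir v w p"
  using assms by (simp add: ddir_add ddir_mult)

section \<open>Left-invariant derivatives\<close>

text \<open>\<open>T = d/dt\<close> has constant coefficients, so it is simply an instance of
  \<open>ddir\<close>.\<close>

abbreviation dT :: "(heis \<Rightarrow> 'b::real_normed_vector) \<Rightarrow> heis \<Rightarrow> 'b" where
  "dT \<equiv> ddir (0, 1)"

definition dZbar :: "(heis \<Rightarrow> complex) \<Rightarrow> heis \<Rightarrow> complex" where
  "dZbar u p = (dX u p + \<i> * dY u p) / 2"

text \<open>Splitting \<open>X\<close> into constant directions with coefficient \<open>2y\<close>
  makes the symmetry of second derivatives applicable.\<close>

lemma dX_coord: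
  assumes "u differentiable (at p)"
  shows "dX u p = ddir (1, 0) u p + (2 * Im (fst p)) *\<^sub>R dT u p"
proof -
  interpret linear "frechet_derivative u (at p)"
    using assms by (rule linear_frechet_derivative)
  have "fieldX p = (1, 0) + (2 * Im (fst p)) *\<^sub>R (0, 1)"
    by (simp add: fieldX_def)
  then show ?thesis unfolding dX_def by (simp only: add scale)
qed

lemma dY_coord:
  assumes "u differentiable (at p)"
  shows "dY u p = ddir (\<i>, 0) u p + (- 2 * Re (fst p)) *\<^sub>R dT u p"
proof -
  interpret linear "frechet_derivative u (at p)"
    using assms by (rule linear_frechet_derivative)
  have "fieldY p = (\<i>, 0) + (- 2 * Re (fst p)) *\<^sub>R (0, 1)"
    by (simp add: fieldY_def)
  then show ?thesis unfolding dY_def by (simp only: add scale)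
qed

text \<open>The kernel of \<open>theta\<close> at \<open>p\<close> is spanned by \<open>X\<close>
  and \<open>Y\<close>, and a vector in it is determined by its \<open>z\<close>-component, which
  supplies the two coefficients.\<close>

lemma ddir_horizontal:
  assumes "u differentiable (at p)" "theta p w = 0"
  shows "ddir w u p = Re (fst w) *\<^sub>R dX u p + Im (fst w) *\<^sub>R dY u p"
proof -
  interpret linear "frechet_derivative u (at p)"
    using assms(1) by (rule linear_frechet_derivative)
  have w: "w = Re (fst w) *\<^sub>R fieldX p + Im (fst w) *\<^sub>R fieldY p"
    using assms(2) by (auto simp: prod_eq_iff fieldX_def fieldY_def theta_def complex_eq_iff algebra_simps)
  show ?thesis unfolding dX_def dY_def by (subst w) (simp only: add scale)
qed

text \<open>These are the coefficients of \<open>T\<close> in \<open>X\<close> and \<open>Y\<close>,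
  made complex so that the product rule for complex functions covers them.\<close>

lemma linear_coord:
  "bounded_linear (\<lambda>p::heis. complex_of_real (2 * Im (fst p)))"
  "bounded_linear (\<lambda>p::heis. complex_of_real (- 2 * Re (fst p)))"
  by (intro bounded_linear_compose[OF bounded_linear_of_real]
      bounded_linear_compose[OF bounded_linear_mult_right]
      bounded_linear_compose[OF bounded_linear_Im] bounded_linear_compose[OF bounded_linear_Re]
      bounded_linear_fst)+

lemma ddir_linear:
  assumes "bounded_linear L"
  shows "ddir v L p = L v"
  using frechet_derivative_at[OF bounded_linear_imp_has_derivative[OF assms]] by metis

section \<open>Commutators of the left-invariant fields\<close>

context
  fixes S :: "heis set" and u :: "heis \<Rightarrow> complex"
  assumes S: "open S" and u: "smooth_on S u"
begin

lemma smooth_on_dX: "smooth_on S (dX u)"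
proof (rule smooth_on_cong[OF S])
  show "smooth_on S (\<lambda>p. ddir (1, 0) u p + complex_of_real (2 * Im (fst p)) * dT u p)"
    by (intro smooth_on_add smooth_on_mult S smooth_on_ddir u smooth_on_linear linear_coord)
qed (simp add: dX_coord[OF smooth_on_differentiable[OF u]] scaleR_conv_of_real)

lemma smooth_on_dY: "smooth_on S (dY u)"
proof (rule smooth_on_cong[OF S])
  show "smooth_on S (\<lambda>p. ddir (\<i>, 0) u p + complex_of_real (- 2 * Re (fst p)) * dT u p)"
    by (intro smooth_on_add smooth_on_mult S smooth_on_ddir u smooth_on_linear linear_coord)
qed (simp add: dY_coord[OF smooth_on_differentiable[OF u]] scaleR_conv_of_real)

lemma smooth_on_dZ: "smooth_on S (dZ u)"
proof (rule smooth_on_cong[OF S])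
  show "smooth_on S (\<lambda>p. 1 / 2 * dX u p + (- \<i> / 2) * dY u p)"
    by (intro smooth_on_add smooth_on_mult S smooth_on_dX smooth_on_dY smooth_on_const)
qed (simp add: dZ_def field_simps)

lemma smooth_on_dZbar: "smooth_on S (dZbar u)"
proof (rule smooth_on_cong[OF S])
  show "smooth_on S (\<lambda>p. 1 / 2 * dX u p + (\<i> / 2) * dY u p)"
    by (intro smooth_on_add smooth_on_mult S smooth_on_dX smooth_on_dY smooth_on_const)
qed (simp add: dZbar_def field_simps)

text \<open>The last term comes from differentiating the coefficient \<open>2y\<close> along
  \<open>v\<close>; it is the source of non-commutativity.\<close>

lemma ddir_dX:
  assumes "p \<in> S"
  shows "ddir v (dX u) p = ddir v (ddir (1, 0) u) p
    + complex_of_real (2 * Im (fst p)) * ddir v (dT u) p + complex_of_real (2 * Im (fst v)) * dT u p"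
proof -
  note diff = smooth_on_differentiable[OF smooth_on_ddir[OF u] assms]
  note lin = linear_coord(1)
  note lin_diff = bounded_linear_imp_differentiable[OF lin, of "at p"]
  have "ddir v (dX u) p
      = ddir v (\<lambda>p. ddir (1, 0) u p + complex_of_real (2 * Im (fst p)) * dT u p) p"
    by (intro ddir_cong[OF S assms])
      (simp add: dX_coord[OF smooth_on_differentiable[OF u]] scaleR_conv_of_real)
  also have "\<dots> = ddir v (ddir (1, 0) u) p + (complex_of_real (2 * Im (fst v)) * dT u p
      + complex_of_real (2 * Im (fst p)) * ddir v (dT u) p)"
    by (simp only: ddir_add[OF diff differentiable_mult[OF lin_diff diff]]
        ddir_mult[OF lin_diff diff] ddir_linear[OF lin])
  finally show ?thesis by simp
qed

lemma ddir_dY: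
  assumes "p \<in> S"
  shows "ddir v (dY u) p = ddir v (ddir (\<i>, 0) u) p
    + complex_of_real (- 2 * Re (fst p)) * ddir v (dT u) p + complex_of_real (- 2 * Re (fst v)) * dT u p"
proof -
  note diff = smooth_on_differentiable[OF smooth_on_ddir[OF u] assms]
  note lin = linear_coord(2)
  note lin_diff = bounded_linear_imp_differentiable[OF lin, of "at p"]
  have "ddir v (dY u) p
      = ddir v (\<lambda>p. ddir (\<i>, 0) u p + complex_of_real (- 2 * Re (fst p)) * dT u p) p"
    by (intro ddir_cong[OF S assms])
      (simp add: dY_coord[OF smooth_on_differentiable[OF u]] scaleR_conv_of_real)
  also have "\<dots> = ddir v (ddir (\<i>, 0) u) p + (complex_of_real (- 2 * Re (fst v)) * dT u p
      + complex_of_real (- 2 * Re (fst p)) * ddir v (dT u) p)"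
    by (simp only: ddir_add[OF diff differentiable_mult[OF lin_diff diff]]
        ddir_mult[OF lin_diff diff] ddir_linear[OF lin])
  finally show ?thesis by simp
qed

text \<open>Second-order terms cancel by symmetry. The coefficient \<open>2y\<close> of
  \<open>X\<close> changes at rate 2 along \<open>Y\<close>, and \<open>-2x\<close> of
  \<open>Y\<close> at rate -2 along \<open>X\<close>, which leaves \<open>4T\<close>.\<close>

lemma dX_dY_commutator:
  assumes p: "p \<in> S"
  shows "dY (dX u) p = dX (dY u) p + 4 * dT u p"
proof -
  note comm = ddir_commute[OF S p smooth_on_Ck[OF u]]
  note diff = smooth_on_differentiable[OF smooth_on_ddir[OF u] p]
  have 1: "dY (dX u) p = dY (ddir (1, 0) u) p + complex_of_real (2 * Im (fst p)) * dY (dT u) p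
      + 2 * dT u p"
    unfolding dY_def ddir_dX[OF p] by (simp add: fieldY_def)
  have 2: "dX (dY u) p = dX (ddir (\<i>, 0) u) p + complex_of_real (- 2 * Re (fst p)) * dX (dT u) p
      - 2 * dT u p"
    unfolding dX_def ddir_dY[OF p] by (simp add: fieldX_def)
  show ?thesis
    unfolding 1 2 dX_coord[OF diff] dY_coord[OF diff] scaleR_conv_of_real
      comm[of "(0, 1)" "(1, 0)"] comm[of "(0, 1)" "(\<i>, 0)"] comm[of "(\<i>, 0)" "(1, 0)"]
    by (simp add: algebra_simps)
qed

text \<open>\<open>T\<close> is central, since the coefficients of \<open>X\<close> and
  \<open>Y\<close> do not depend on \<open>t\<close>.\<close>

lemma dT_dX_dY_commute:
  assumes p: "p \<in> S"
  shows "dT (dX u) p = dX (dT u) p" "dT (dY u) p = dY (dT u) p"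
proof -
  note comm = ddir_commute[OF S p smooth_on_Ck[OF u]]
  note diff = smooth_on_differentiable[OF smooth_on_ddir[OF u] p]
  show "dT (dX u) p = dX (dT u) p"
    unfolding ddir_dX[OF p] dX_coord[OF diff] scaleR_conv_of_real by (simp add: comm[of "(0, 1)" "(1, 0)"])
  show "dT (dY u) p = dY (dT u) p"
    unfolding ddir_dY[OF p] dY_coord[OF diff] scaleR_conv_of_real by (simp add: comm[of "(0, 1)" "(\<i>, 0)"])
qed

lemma ddir_dZ:
  assumes p: "p \<in> S"
  shows "ddir v (dZ u) p = (ddir v (dX u) p - \<i> * ddir v (dY u) p) / 2"
proof -
  have "dZ u = (\<lambda>q. 1 / 2 * dX u q + (- \<i> / 2) * dY u q)"
    by (simp add: fun_eq_iff dZ_def field_simps)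
  then show ?thesis
    using ddir_lincomb[OF smooth_on_differentiable[OF smooth_on_dX p]
        smooth_on_differentiable[OF smooth_on_dY p], where v = v and c = "1 / 2" and d = "- \<i> / 2"]
    by (simp add: field_simps)
qed

lemma ddir_dZbar:
  assumes p: "p \<in> S"
  shows "ddir v (dZbar u) p = (ddir v (dX u) p + \<i> * ddir v (dY u) p) / 2"
proof -
  have "dZbar u = (\<lambda>q. 1 / 2 * dX u q + (\<i> / 2) * dY u q)"
    by (simp add: fun_eq_iff dZbar_def field_simps)
  then show ?thesis
    using ddir_lincomb[OF smooth_on_differentiable[OF smooth_on_dX p]
        smooth_on_differentiable[OF smooth_on_dY p], where v = v and c = "1 / 2" and d = "\<i> / 2"]
    by (simp add: field_simps)
qed

text \<open>In \<open>(X + iY)(X - iY) - (X - iY)(X + iY)\<close> the squares cancel and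
  \<open>2i(YX - XY) = 8iT\<close> remains; a quarter of it is \<open>2iT\<close>.\<close>

lemma dZ_dZbar_commutator:
  assumes p: "p \<in> S"
  shows "dZbar (dZ u) p = dZ (dZbar u) p + 2 * \<i> * dT u p"
proof -
  have "dX (dZ u) p = (dX (dX u) p - \<i> * dX (dY u) p) / 2"
    "dY (dZ u) p = (dY (dX u) p - \<i> * dY (dY u) p) / 2"
    "dX (dZbar u) p = (dX (dX u) p + \<i> * dX (dY u) p) / 2"
    "dY (dZbar u) p = (dY (dX u) p + \<i> * dY (dY u) p) / 2"
    \<comment> \<open>Only the outer derivatives are unfolded; the inner \<open>dX u\<close> and
      \<open>dY u\<close> stay intact for the commutator rule.\<close>
    by (simp_all only: dX_def[of "dZ u"] dY_def[of "dZ u"] dX_def[of "dZbar u"] dY_def[of "dZbar u"]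
        dX_def[of "dX u"] dY_def[of "dX u"] dX_def[of "dY u"] dY_def[of "dY u"] ddir_dZ[OF p] ddir_dZbar[OF p])
  then show ?thesis
    unfolding dZ_def[of "dZbar u"] dZbar_def[of "dZ u"]
    by (simp only: dX_dY_commutator[OF p]) (simp add: field_simps)
qed

lemma dT_dZ_commute: "p \<in> S \<Longrightarrow> dT (dZ u) p = dZ (dT u) p"
  by (simp add: ddir_dZ dT_dX_dY_commute dZ_def)

end

section \<open>Calculus rules for \<open>Z\<close> and \<open>Zbar\<close>\<close>

lemma dZ_cong:
  assumes "open S" "p \<in> S" "\<And>q. q \<in> S \<Longrightarrow> u q = w q"
  shows "dZ u p = dZ w p" "dZbar u p = dZbar w p"
  using ddir_cong[OF assms] by (simp_all add: dZ_def dZbar_def dX_def dY_def)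

lemma dZ_cnj:
  assumes "u differentiable (at p)"
  shows "dZ (\<lambda>q. cnj (u q)) p = cnj (dZbar u p)" "dZbar (\<lambda>q. cnj (u q)) p = cnj (dZ u p)"
  using ddir_cnj[OF assms] by (simp_all add: dZ_def dZbar_def dX_def dY_def)

lemma dZ_mult:
  assumes "u differentiable (at p)" "w differentiable (at p)"
  shows "dZ (\<lambda>q. u q * w q) p = dZ u p * w p + u p * dZ w p"
    "dZbar (\<lambda>q. u q * w q) p = dZbar u p * w p + u p * dZbar w p"
  using ddir_mult[OF assms] by (simp_all add: dZ_def dZbar_def dX_def dY_def field_simps)

text \<open>Sums to be differentiated later are brought to this two-term shape, with coefficients 1
  or 0 as padding, so that the rule can rewrite them.\<close>

lemma dZ_lincomb:
  assumes "u differentiable (at p)" "w differentiable (at p)"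
  shows "dZ (\<lambda>q. c * u q + d * w q) p = c * dZ u p + d * dZ w p"
    "dZbar (\<lambda>q. c * u q + d * w q) p = c * dZbar u p + d * dZbar w p"
  using ddir_lincomb[OF assms] by (simp_all add: dZ_def dZbar_def dX_def dY_def field_simps)

lemma dZ_inverse:
  assumes "u differentiable (at p)" "u p \<noteq> 0"
  shows "dZ (\<lambda>q. inverse (u q)) p = - dZ u p * (inverse (u p))\<^sup>2"
  unfolding dZ_def dX_def dY_def ddir_inverse[OF assms]
  by (simp add: algebra_simps power2_eq_square diff_divide_distrib)

text \<open>A contact map sends horizontal vectors to horizontal ones, so no \<open>T u\<close> term
  appears, and the chain rule looks like the Wirtinger one in a single complex variable.\<close>

lemma dZ_compose_contact:
  assumes g: "g differentiable (at p)" and u: "u differentiable (at (g p))"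
    and contact: "\<And>v. pullback_theta g p v = l * theta p v"
  shows "dZ (\<lambda>q. u (g q)) p
    = dZ u (g p) * dZ (\<lambda>q. fst (g q)) p + dZbar u (g p) * dZ (\<lambda>q. cnj (fst (g q))) p"
proof -
  have fst: "(\<lambda>q. fst (g q)) differentiable (at p)" "ddir v (\<lambda>q. fst (g q)) p = fst (ddir v g p)" for v
    using g bounded_linear.has_derivative[OF bounded_linear_fst] unfolding differentiable_def
    by (blast, intro ddir_linear_compose bounded_linear_fst g)
  have *: "ddir v (\<lambda>q. u (g q)) p = Re (fst (ddir v g p)) *\<^sub>R dX u (g p) + Im (fst (ddir v g p)) *\<^sub>R dY u (g p)"
    if "theta p v = 0" for v
    unfolding ddir_compose[OF g u]
    using that contact[of v] by (intro ddir_horizontal[OF u]) (simp add: pullback_theta_def)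
  have "theta p (fieldX p) = 0" "theta p (fieldY p) = 0"
    by (simp_all add: theta_def fieldX_def fieldY_def)
  note * = this[THEN *]
  \<comment> \<open>A real combination of \<open>X u\<close> and \<open>Y u\<close> becomes a
    complex one of \<open>Z u\<close> and \<open>Zbar u\<close>.\<close>
  have cmb: "Re z *\<^sub>R A + Im z *\<^sub>R B = z * ((A - \<i> * B) / 2) + cnj z * ((A + \<i> * B) / 2)" for z A B :: complex
    by (simp add: complex_eq_iff field_simps)
  show ?thesis
    unfolding dZ_def[of "\<lambda>q. u (g q)"] dX_def[of "\<lambda>q. u (g q)"] dY_def[of "\<lambda>q. u (g q)"] * cmb
    unfolding dZ_def dZbar_def dX_def[of "\<lambda>q. fst (g q)"] dY_def[of "\<lambda>q. fst (g q)"]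
      dX_def[of "\<lambda>q. cnj (fst (g q))"] dY_def[of "\<lambda>q. cnj (fst (g q))"] fst ddir_cnj[OF fst(1)]
    by (simp add: field_simps)
qed

section \<open>Contact and conformal maps\<close>

text \<open>Trades the existentially given factor for the definite description, which uniqueness
  makes the same number.\<close>

lemma pos_contact_pullback:
  assumes "pos_contact_on S f" "p \<in> S"
  shows "pullback_theta f p v = contact_factor f p * theta p v" "contact_factor f p > 0"
proof -
  obtain l where l: "\<forall>v. pullback_theta f p v = l * theta p v"
    using assms unfolding pos_contact_on_def contact_on_def by blast
  show "pullback_theta f p v = contact_factor f p * theta p v"
    unfolding contact_factor_unique[OF l] by (rule l[rule_format])
  show "contact_factor f p > 0"
    using assms unfolding pos_contact_on_def by blast
qed

lemma bounded_linear_of_real_snd: "bounded_linear (\<lambda>p::heis. complex_of_real (snd p))"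
  by (intro bounded_linear_compose[OF bounded_linear_of_real] bounded_linear_snd)

section \<open>Contact equations and the contact factor\<close>

locale smooth_contact =
  fixes S :: "heis set" and f :: "heis \<Rightarrow> heis"
  assumes S: "open S" and smooth: "smooth_on S f" and contact: "pos_contact_on S f"
begin

text \<open>\<open>F\<close>, \<open>Fb\<close> and \<open>H\<close> are \<open>f\<^sub>1 + i f\<^sub>2\<close>, its conjugate and \<open>f\<^sub>3\<close>; \<open>L\<close> is the contact
  factor. Real quantities are embedded in the complex numbers so that \<open>Z\<close> applies to them.\<close>

definition F :: "heis \<Rightarrow> complex" where "F p = fst (f p)"
definition Fb :: "heis \<Rightarrow> complex" where "Fb p = cnj (F p)"
definition H :: "heis \<Rightarrow> complex" where "H p = complex_of_real (snd (f p))"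
definition L :: "heis \<Rightarrow> complex" where "L p = complex_of_real (contact_factor f p)"

lemma smooth_F: "smooth_on S F"
  unfolding F_def by (intro smooth_on_linear_compose[OF bounded_linear_fst] S smooth)

lemma smooth_Fb: "smooth_on S Fb"
  unfolding Fb_def by (intro smooth_on_cnj S smooth_F)

lemma smooth_H: "smooth_on S H"
  unfolding H_def by (intro smooth_on_linear_compose[OF bounded_linear_of_real_snd] S smooth)

lemmas smooth_rules = smooth_F smooth_Fb smooth_H

lemma L_nonzero: "p \<in> S \<Longrightarrow> L p \<noteq> 0"
  unfolding L_def using pos_contact_pullback(2)[OF contact] by fastforce

lemma dZ_Fb:
  assumes "p \<in> S"
  shows "dZ Fb p = cnj (dZbar F p)" "dZbar Fb p = cnj (dZ F p)" "dT Fb p = cnj (dT F p)"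
  unfolding Fb_def
  by (intro dZ_cnj ddir_cnj smooth_on_differentiable[OF smooth_F assms])+

text \<open>The contact equation solved for \<open>df_3\<close>, using that
  \<open>2 f_2 df_1 - 2 f_1 df_2\<close> equals \<open>i\<close> times
  \<open>Fb dF - F dFb\<close>.\<close>

lemma ddir_H:
  assumes p: "p \<in> S"
  shows "ddir v H p = \<i> * (Fb p * ddir v F p - F p * ddir v Fb p) + L p * complex_of_real (theta p v)"
proof -
  note diff = smooth_on_differentiable[OF smooth p]
  have D: "ddir v F p = fst (ddir v f p)" "ddir v H p = complex_of_real (snd (ddir v f p))"
    unfolding F_def H_def
    by (intro ddir_linear_compose[OF bounded_linear_fst diff]
        ddir_linear_compose[OF bounded_linear_of_real_snd diff])+
  have Fb: "ddir v Fb p = cnj (ddir v F p)"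
    unfolding Fb_def by (intro ddir_cnj smooth_on_differentiable[OF smooth_F p])
  show ?thesis
    using pos_contact_pullback(1)[OF contact p, of v]
    unfolding Fb D pullback_theta_def Fb_def F_def L_def theta_def[of "f p"]
    by (simp add: complex_eq_iff algebra_simps)
qed

lemma dT_H:
  assumes "p \<in> S"
  shows "dT H p = \<i> * (Fb p * dT F p - F p * dT Fb p) + L p"
  using ddir_H[OF assms, of "(0, 1)"] by (simp add: theta_def)

text \<open>\<open>X\<close> and \<open>Y\<close> lie in the kernel of \<open>theta\<close>, so the
  term with the contact factor drops out of \<open>ddir_H\<close>.\<close>

lemma dZ_H:
  assumes "p \<in> S"
  shows "dZ H p = \<i> * Fb p * dZ F p + (- \<i>) * F p * dZ Fb p"
    "dZbar H p = \<i> * Fb p * dZbar F p + (- \<i>) * F p * dZbar Fb p"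
proof -
  have "theta p (fieldX p) = 0" "theta p (fieldY p) = 0"
    by (simp_all add: theta_def fieldX_def fieldY_def)
  note XY = this[THEN arg_cong[where f = complex_of_real]]
  show "dZ H p = \<i> * Fb p * dZ F p + (- \<i>) * F p * dZ Fb p"
    "dZbar H p = \<i> * Fb p * dZbar F p + (- \<i>) * F p * dZbar Fb p"
    unfolding dZ_def dZbar_def dX_def dY_def ddir_H[OF assms] XY by (simp_all add: field_simps)
qed

text \<open>A definite description carries no regularity by itself; \<open>dT_H\<close> solved for
  \<open>L\<close> expresses it through derivatives of the components of \<open>f\<close>.\<close>

lemma smooth_L: "smooth_on S L"
proof (rule smooth_on_cong[OF S])
  show "smooth_on S (\<lambda>p. dT H p + ((- \<i>) * (Fb p * dT F p) + \<i> * (F p * dT Fb p)))"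
    by (intro smooth_on_add smooth_on_mult smooth_on_const smooth_on_ddir smooth_rules S)
qed (simp add: dT_H algebra_simps)

lemma diff:
  assumes "p \<in> S"
  shows "F differentiable (at p)" "Fb differentiable (at p)" "H differentiable (at p)"
    "L differentiable (at p)"
    "dZ F differentiable (at p)" "dZ Fb differentiable (at p)" "dZ H differentiable (at p)"
    "dZbar F differentiable (at p)" "dZbar Fb differentiable (at p)"
    "ddir v F differentiable (at p)" "ddir v Fb differentiable (at p)" "ddir v H differentiable (at p)"
  by (intro smooth_on_differentiable[OF _ assms] smooth_on_dZ smooth_on_dZbar smooth_on_ddir
      smooth_rules S smooth_L)+

text \<open>Expanding both orders of differentiation of \<open>H\<close>, the second-order terms in
  \<open>F\<close> and \<open>Fb\<close> combine through the commutator into \<open>T F\<close> and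
  \<open>T Fb\<close>. These cancel against the same terms in \<open>dT_H\<close>, leaving
  \<open>2iL\<close>.\<close>

lemma L_eq:
  assumes p: "p \<in> S"
  shows "L p = dZ F p * dZbar Fb p - dZbar F p * dZ Fb p"
proof -
  note d = diff[OF p]
  have "dZbar (dZ H) p = dZbar (\<lambda>q. \<i> * (Fb q * dZ F q) + (- \<i>) * (F q * dZ Fb q)) p"
    by (intro dZ_cong[OF S p]) (simp add: dZ_H)
  also have "\<dots> = \<i> * (dZbar Fb p * dZ F p + Fb p * dZbar (dZ F) p)
      + (- \<i>) * (dZbar F p * dZ Fb p + F p * dZbar (dZ Fb) p)"
    by (simp only: dZ_lincomb dZ_mult d differentiable_mult)
  finally have 1: "dZbar (dZ H) p = \<dots>" .
  have "dZ (dZbar H) p = dZ (\<lambda>q. \<i> * (Fb q * dZbar F q) + (- \<i>) * (F q * dZbar Fb q)) p"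
    by (intro dZ_cong[OF S p]) (simp add: dZ_H)
  also have "\<dots> = \<i> * (dZ Fb p * dZbar F p + Fb p * dZ (dZbar F) p)
      + (- \<i>) * (dZ F p * dZbar Fb p + F p * dZ (dZbar Fb) p)"
    by (simp only: dZ_lincomb dZ_mult d differentiable_mult)
  finally have 2: "dZ (dZbar H) p = \<dots>" .
  note comm = dZ_dZbar_commutator[OF S _ p]
  have "2 * \<i> * L p = 2 * \<i> * (dZ F p * dZbar Fb p - dZbar F p * dZ Fb p)"
    using comm[OF smooth_H] unfolding 1 2 comm[OF smooth_F] comm[OF smooth_Fb] dT_H[OF p]
    by (simp add: algebra_simps)
  then show ?thesis by simp
qed

end

section \<open>Conformal maps and the derivatives of their contact factor\<close>

locale smooth_conformal = smooth_contact +
  assumes conformal: "conformal_on S f"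
begin

text \<open>Up to constant factors, the two conformality equations are the real and imaginary parts
  of \<open>ZF * cnj (Zbar F) = 0\<close>. At a point with \<open>ZF = 0\<close> the contact factor
  would be \<open>-|Zbar F|^2\<close>, against positive orientation.\<close>

lemma dZbar_F:
  assumes p: "p \<in> S"
  shows "dZbar F p = 0"
proof -
  note d = diff(1)[OF p]
  have R: "dX (\<lambda>q. Re (fst (f q))) p = Re (dX F p)" "dX (\<lambda>q. Im (fst (f q))) p = Im (dX F p)"
    "dY (\<lambda>q. Re (fst (f q))) p = Re (dY F p)" "dY (\<lambda>q. Im (fst (f q))) p = Im (dY F p)"
    unfolding dX_def dY_def F_def
    by (intro ddir_linear_compose bounded_linear_Re bounded_linear_Im d[unfolded F_def])+
  have c: "(Re (dX F p))\<^sup>2 + (Im (dX F p))\<^sup>2 = (Re (dY F p))\<^sup>2 + (Im (dY F p))\<^sup>2"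
    "Re (dX F p) * Re (dY F p) + Im (dX F p) * Im (dY F p) = 0"
    using conformal p unfolding conformal_on_def Let_def R[symmetric] by blast+
  have "4 * (dZ F p * cnj (dZbar F p)) = (dX F p - \<i> * dY F p) * cnj (dX F p + \<i> * dY F p)"
    by (simp add: dZ_def dZbar_def)
  also have "\<dots> = 0"
    using c by (simp add: complex_eq_iff algebra_simps power2_eq_square)
  finally have "dZ F p = 0 \<or> dZbar F p = 0" by simp
  moreover have False if "dZ F p = 0"
  proof -
    have "L p = - (dZbar F p * cnj (dZbar F p))"
      using that L_eq[OF p] dZ_Fb[OF p] by simp
    then have "Re (L p) \<le> 0"
      by (simp add: complex_mult_cnj)
    then show False
      using pos_contact_pullback(2)[OF contact p] by (simp add: L_def)
  qed
  ultimately show ?thesis by blast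
qed

lemma dZ_Fb_zero: "p \<in> S \<Longrightarrow> dZ Fb p = 0"
  by (simp add: dZ_Fb dZbar_F)

lemma L_eq_mult: "p \<in> S \<Longrightarrow> L p = dZ F p * dZbar Fb p"
  by (simp add: L_eq dZbar_F)

lemma nonzero:
  assumes "p \<in> S" shows "dZ F p \<noteq> 0" "dZbar Fb p \<noteq> 0"
  using L_nonzero[OF assms] L_eq_mult[OF assms] by auto

text \<open>The commutator applied to \<open>Fb\<close>: \<open>Z Fb\<close> vanishes on the whole
  open set, hence so does \<open>Zbar (Z Fb)\<close>.\<close>

lemma dZ_dZbar_Fb:
  assumes p: "p \<in> S"
  shows "dZ (dZbar Fb) p = - 2 * \<i> * dT Fb p"
proof -
  have "dZbar (dZ Fb) p = dZbar (\<lambda>_. 0) p"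
    by (intro dZ_cong[OF S p] dZ_Fb_zero)
  also have "\<dots> = 0"
    by (simp add: dZbar_def dX_def dY_def)
  finally have "dZ (dZbar Fb) p + 2 * \<i> * dT Fb p = 0"
    using dZ_dZbar_commutator[OF S smooth_Fb p] by simp
  then show ?thesis
    by (simp add: eq_neg_iff_add_eq_0)
qed

lemma dZ_dT_Fb:
  assumes p: "p \<in> S"
  shows "dZ (dT Fb) p = 0"
proof -
  have "dT (dZ Fb) p = dT (\<lambda>_. 0) p"
    by (intro ddir_cong[OF S p] dZ_Fb_zero)
  then show ?thesis
    using dT_dZ_commute[OF S smooth_Fb p] by simp
qed

lemma dZ_dZ_dZbar_Fb:
  assumes p: "p \<in> S"
  shows "dZ (dZ (dZbar Fb)) p = 0"
proof -
  have "dZ (dZ (dZbar Fb)) p = dZ (\<lambda>q. - 2 * \<i> * dT Fb q + 0 * dT Fb q) p"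
    by (intro dZ_cong[OF S p]) (simp add: dZ_dZbar_Fb)
  also have "\<dots> = - 2 * \<i> * dZ (dT Fb) p + 0 * dZ (dT Fb) p"
    by (intro dZ_lincomb diff[OF p])
  finally show ?thesis using dZ_dT_Fb[OF p] by simp
qed

text \<open>Differentiating the formula from \<open>dT_H\<close>, rather than the product
  \<open>L_eq_mult\<close>, gives an expression free of \<open>Z (Z F)\<close>; comparing the two
  formulas then determines that term.\<close>

lemma dZ_L:
  assumes p: "p \<in> S"
  shows "dZ L p = 2 * \<i> * dZ F p * dT Fb p"
proof -
  note d = diff[OF p]
  have "dZ L p = dZ (\<lambda>q. 1 * dT H q + (- \<i>) * (1 * (Fb q * dT F q) + (- 1) * (F q * dT Fb q))) p"
    by (intro dZ_cong[OF S p]) (simp add: dT_H algebra_simps)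
  also have "\<dots> = 1 * dZ (dT H) p + (- \<i>) * (1 * (dZ Fb p * dT F p + Fb p * dZ (dT F) p)
      + (- 1) * (dZ F p * dT Fb p + F p * dZ (dT Fb) p))"
    by (simp only: dZ_lincomb dZ_mult d differentiable_mult differentiable_add differentiable_const)
  also have "\<dots> = dT (dZ H) p + (- \<i>) * (Fb p * dT (dZ F) p - dZ F p * dT Fb p)"
    using dT_dZ_commute[OF S smooth_H p] dT_dZ_commute[OF S smooth_F p]
    by (simp add: dZ_Fb_zero[OF p] dZ_dT_Fb[OF p])
  \<comment> \<open>As \<open>Z H = i Fb ZF\<close> on \<open>S\<close>, its
    \<open>T\<close>-derivative contains \<open>i Fb T(ZF)\<close>, which cancels the term already
    present.\<close>
  also have "dT (dZ H) p = dT (\<lambda>q. \<i> * (Fb q * dZ F q) + 0 * Fb q) p"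
    by (intro ddir_cong[OF S p]) (simp add: dZ_H dZ_Fb_zero)
  also have "\<dots> = \<i> * (dT Fb p * dZ F p + Fb p * dT (dZ F) p) + 0 * dT Fb p"
    by (simp only: ddir_lincomb ddir_mult d differentiable_mult)
  finally show ?thesis by (simp add: algebra_simps)
qed

text \<open>With \<open>a = ZF\<close> and \<open>b = Zbar Fb\<close>, the product rule gives
  \<open>Z L = b Za + a Zb\<close>, while \<open>dZ_L\<close> amounts to
  \<open>Z L = -a Zb\<close>.\<close>

lemma dZ_dZ_F:
  assumes p: "p \<in> S"
  shows "dZ (dZ F) p * dZbar Fb p = - 2 * dZ F p * dZ (dZbar Fb) p"
proof -
  have "dZ L p = dZ (\<lambda>q. dZ F q * dZbar Fb q) p"
    by (intro dZ_cong[OF S p] L_eq_mult)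
  also have "\<dots> = dZ (dZ F) p * dZbar Fb p + dZ F p * dZ (dZbar Fb) p"
    by (intro dZ_mult diff[OF p])
  finally show ?thesis
    unfolding dZ_L[OF p] dZ_dZbar_Fb[OF p] by (simp add: algebra_simps)
qed

text \<open>The form \<open>Zb / (a b^2)\<close>, with \<open>a = ZF\<close> and
  \<open>b = Zbar Fb\<close>, is chosen because \<open>Z\<close> annihilates numerator and
  denominator separately.\<close>

lemma dZ_inverse_L:
  assumes p: "p \<in> S"
  shows "dZ (\<lambda>q. inverse (L q)) p
    = dZ (dZbar Fb) p * inverse (dZ F p * (dZbar Fb p * dZbar Fb p))"
proof -
  note n = nonzero[OF p]
  have "dZ (\<lambda>q. inverse (L q)) p = - dZ L p * (inverse (L p))\<^sup>2"
    by (intro dZ_inverse diff[OF p] L_nonzero[OF p])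
  also have "dZ L p = - dZ F p * dZ (dZbar Fb) p"
    by (simp add: dZ_L[OF p] dZ_dZbar_Fb[OF p])
  finally show ?thesis
    using n by (simp add: L_eq_mult[OF p] field_simps power2_eq_square)
qed

text \<open>In this notation \<open>Z(a b^2) = b (b Za + 2 a Zb) = 0\<close> by
  \<open>dZ_dZ_F\<close>, and \<open>Z(Zb) = 0\<close>. In effect, \<open>g\<close> has vanishing
  Schwarzian when it is conformal.\<close>

lemma dZ_dZ_inverse_L:
  assumes p: "p \<in> S"
  shows "dZ (dZ (\<lambda>q. inverse (L q))) p = 0"
proof -
  let ?k = "\<lambda>q. dZ F q * (dZbar Fb q * dZbar Fb q)"
  note d = diff[OF p] and n = nonzero[OF p]
  have dk: "?k differentiable (at p)" by (intro differentiable_mult d)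
  have b: "dZ (dZbar Fb) differentiable (at p)"
    by (intro smooth_on_differentiable[OF _ p] smooth_on_dZ smooth_on_dZbar smooth_rules S)
  have "dZ ?k p = dZ (dZ F) p * (dZbar Fb p * dZbar Fb p)
      + dZ F p * (dZ (dZbar Fb) p * dZbar Fb p + dZbar Fb p * dZ (dZbar Fb) p)"
    by (simp only: dZ_mult d differentiable_mult)
  also have "\<dots> = dZbar Fb p * (dZ (dZ F) p * dZbar Fb p + 2 * dZ F p * dZ (dZbar Fb) p)"
    by (simp add: algebra_simps)
  also have "\<dots> = 0"
    unfolding dZ_dZ_F[OF p] by simp
  finally have k: "dZ ?k p = 0" .
  have "dZ (dZ (\<lambda>q. inverse (L q))) p = dZ (\<lambda>q. dZ (dZbar Fb) q * inverse (?k q)) p"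
    by (intro dZ_cong[OF S p] dZ_inverse_L)
  also have "\<dots> = dZ (dZ (dZbar Fb)) p * inverse (?k p)
      + dZ (dZbar Fb) p * dZ (\<lambda>q. inverse (?k q)) p"
    using n by (intro dZ_mult b differentiable_inverse dk) auto
  also have "dZ (\<lambda>q. inverse (?k q)) p = - dZ ?k p * (inverse (?k p))\<^sup>2"
    using n by (intro dZ_inverse dk) auto
  finally show ?thesis by (simp add: k dZ_dZ_dZbar_Fb[OF p])
qed

text \<open>The left side is the coefficient of \<open>Z u\<close> when \<open>Z\<close> is applied
  twice to \<open>(u o f) / L\<close>.\<close>

lemma dZ_F_dZ_inverse_L:
  assumes p: "p \<in> S"
  shows "dZ (dZ F) p * inverse (L p) + 2 * dZ F p * dZ (\<lambda>q. inverse (L q)) p = 0"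
proof -
  note n = nonzero[OF p]
  have "dZ (dZ F) p = - 2 * dZ F p * dZ (dZbar Fb) p / dZbar Fb p"
    using dZ_dZ_F[OF p] n by (simp add: field_simps)
  then show ?thesis
    using n unfolding dZ_inverse_L[OF p] by (simp add: L_eq_mult[OF p] field_simps)
qed

text \<open>The \<open>Zbar u\<close> term of the contact chain rule carries the factor
  \<open>Z Fb\<close>, which is zero.\<close>

lemma dZ_compose:
  assumes "p \<in> S" "u differentiable (at (f p))"
  shows "dZ (\<lambda>q. u (f q)) p = dZ u (f p) * dZ F p"
  using dZ_compose_contact[OF smooth_on_differentiable[OF smooth assms(1)] assms(2)
      pos_contact_pullback(1)[OF contact assms(1)], folded F_def, folded Fb_def] dZ_Fb_zero[OF assms(1)]
  by simp

text \<open>Leibniz expansion in which only the top-order term survives; in the theorem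
  \<open>u\<close> is the reciprocal contact factor of the outer map.\<close>

lemma dZ_dZ_compose_mult_inverse_L:
  assumes U: "open U" "smooth_on U u" "f ` S \<subseteq> U" and p: "p \<in> S"
  shows "dZ (dZ (\<lambda>q. u (f q) * inverse (L q))) p = dZ (dZ u) (f p) * (dZ F p)\<^sup>2 * inverse (L p)"
proof -
  let ?v = "\<lambda>q. inverse (L q)"
  have sv: "smooth_on S ?v"
    by (intro smooth_on_inverse S smooth_L L_nonzero)
  have d: "u differentiable (at (f q))" "dZ u differentiable (at (f q))" "?v differentiable (at q)"
    "dZ ?v differentiable (at q)" "(\<lambda>q. u (f q)) differentiable (at q)"
    "(\<lambda>q. dZ u (f q)) differentiable (at q)" "dZ F differentiable (at q)" if q: "q \<in> S" for q
  proof -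
    have fq: "f q \<in> U" using q U by blast
    show u: "u differentiable (at (f q))" "dZ u differentiable (at (f q))"
      by (intro smooth_on_differentiable[OF _ fq] smooth_on_dZ U)+
    show "?v differentiable (at q)" "dZ ?v differentiable (at q)"
      by (intro smooth_on_differentiable[OF _ q] smooth_on_dZ sv S)+
    have "f differentiable (at q)" by (rule smooth_on_differentiable[OF smooth q])
    from differentiable_chain_at[OF this u(1)] differentiable_chain_at[OF this u(2)]
    show "(\<lambda>q. u (f q)) differentiable (at q)" "(\<lambda>q. dZ u (f q)) differentiable (at q)"
      by (simp_all add: comp_def)
  qed (rule diff[OF q])
  have "dZ (\<lambda>q. u (f q) * ?v q) q = dZ u (f q) * (dZ F q * ?v q) + u (f q) * dZ ?v q"
    if q: "q \<in> S" for q
    using dZ_mult(1)[OF d(5,3)[OF q]] dZ_compose[OF q d(1)[OF q]] by simp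
  then have "dZ (dZ (\<lambda>q. u (f q) * ?v q)) p
      = dZ (\<lambda>q. 1 * (dZ u (f q) * (dZ F q * ?v q)) + 1 * (u (f q) * dZ ?v q)) p"
    by (intro dZ_cong[OF S p]) simp
  also have "\<dots> = 1 * (dZ (\<lambda>q. dZ u (f q)) p * (dZ F p * ?v p)
        + dZ u (f p) * (dZ (dZ F) p * ?v p + dZ F p * dZ ?v p))
      + 1 * (dZ (\<lambda>q. u (f q)) p * dZ ?v p + u (f p) * dZ (dZ ?v) p)"
    by (simp only: dZ_lincomb dZ_mult d[OF p] differentiable_mult)
  \<comment> \<open>Terms are grouped by the order of differentiation of \<open>u\<close>; the last
    two groups vanish by the preceding identities.\<close>
  also have "\<dots> = dZ (dZ u) (f p) * (dZ F p)\<^sup>2 * ?v p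
      + dZ u (f p) * (dZ (dZ F) p * ?v p + 2 * dZ F p * dZ ?v p) + u (f p) * dZ (dZ ?v) p"
    by (simp add: dZ_compose[OF p] d[OF p] algebra_simps power2_eq_square)
  finally show ?thesis
    unfolding dZ_F_dZ_inverse_L[OF p] dZ_dZ_inverse_L[OF p] by simp
qed

end

section \<open>Multiplicativity of contact factors and the transformation law\<close>

lemma contact_factor_compose:
  assumes "g differentiable (at p)" "f differentiable (at (g p))"
    and "\<And>v. pullback_theta g p v = l * theta p v"
    and "\<And>v. pullback_theta f (g p) v = k * theta (g p) v"
  shows "contact_factor (f \<circ> g) p = k * l"
proof (rule contact_factor_unique, rule allI)
  show "pullback_theta (f \<circ> g) p v = k * l * theta p v" for v
    using assms(3,4) frechet_derivative_compose[OF assms(1,2)]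
    by (simp add: pullback_theta_def mult.assoc)
qed

theorem claim1:
  fixes \<Omega> \<Omega>' :: "heis set" and f g :: "heis \<Rightarrow> heis"
  assumes "open \<Omega>" and "open \<Omega>'"
    and "smooth_on \<Omega> f" and "pos_contact_on \<Omega> f"
    and "g ` \<Omega>' \<subseteq> \<Omega>"
    and "smooth_on \<Omega>' g" and "conformal_on \<Omega>' g" and "pos_contact_on \<Omega>' g"
  shows "\<forall>p\<in>\<Omega>'. S_CR (f \<circ> g) p = S_CR f (g p) * (dZ (\<lambda>q. fst (g q)) p)\<^sup>2"
proof
  fix p assume p: "p \<in> \<Omega>'"
  interpret f: smooth_contact \<Omega> f
    using assms by unfold_locales
  interpret g: smooth_conformal \<Omega>' g
    using assms by unfold_locales
  let ?u = "\<lambda>q. inverse (f.L q)"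
  have cf: "contact_factor (f \<circ> g) q = contact_factor f (g q) * contact_factor g q"
    if q: "q \<in> \<Omega>'" for q
  proof -
    have "g q \<in> \<Omega>" using q assms(5) by blast
    then show ?thesis
      by (intro contact_factor_compose smooth_on_differentiable[OF assms(6) q]
          smooth_on_differentiable[OF assms(3)] pos_contact_pullback(1)[OF assms(8) q]
          pos_contact_pullback(1)[OF assms(4)])
  qed
  have inv: "complex_of_real (inverse (contact_factor (f \<circ> g) q)) = ?u (g q) * inverse (g.L q)"
    if "q \<in> \<Omega>'" for q
    by (simp add: cf[OF that] f.L_def g.L_def)
  \<comment> \<open>The factorisation is known only on \<Omega>', so the first derivatives are
    identified on that whole open set before differentiating again.\<close>
  have "dZ (\<lambda>q. complex_of_real (inverse (contact_factor (f \<circ> g) q))) q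
      = dZ (\<lambda>q. ?u (g q) * inverse (g.L q)) q" if "q \<in> \<Omega>'" for q
    by (intro dZ_cong[OF assms(2) that] inv)
  then have "dZ (dZ (\<lambda>q. complex_of_real (inverse (contact_factor (f \<circ> g) q)))) p
      = dZ (dZ (\<lambda>q. ?u (g q) * inverse (g.L q))) p"
    by (rule dZ_cong[OF assms(2) p])
  also have "\<dots> = dZ (dZ ?u) (g p) * (dZ g.F p)\<^sup>2 * inverse (g.L p)"
    by (intro g.dZ_dZ_compose_mult_inverse_L[OF assms(1) _ assms(5) p]
        smooth_on_inverse assms(1) f.smooth_L f.L_nonzero)
  finally have "S_CR (f \<circ> g) p
      = 1 / 2 * (f.L (g p) * g.L p) * (dZ (dZ ?u) (g p) * (dZ g.F p)\<^sup>2 * inverse (g.L p))"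
    by (simp only: S_CR_def cf[OF p] f.L_def g.L_def of_real_mult)
  \<comment> \<open>The contact factor of \<open>g\<close> inside that of the composite cancels the
    remaining reciprocal.\<close>
  also have "\<dots> = 1 / 2 * f.L (g p) * dZ (dZ ?u) (g p) * (dZ g.F p)\<^sup>2"
    using g.L_nonzero[OF p] by (simp add: field_simps)
  also have "\<dots> = S_CR f (g p) * (dZ (\<lambda>q. fst (g q)) p)\<^sup>2"
    by (simp add: S_CR_def f.L_def[abs_def] g.F_def[abs_def] of_real_inverse)
  finally show "S_CR (f \<circ> g) p = S_CR f (g p) * (dZ (\<lambda>q. fst (g q)) p)\<^sup>2" .
qed

end
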